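(* $k_0(l_\infty) \le 20.5$.
   Context: $l_\infty$ is the Banach space of bounded real sequences $x=(x_n)_{n\ge1}$ with the norm $\|x\|=\sup_n|x_n|$. For a Banach space $X$, $B_X=\{x\in X:\|x\|\le 1\}$ denotes the (closed) unit ball and $S_X=\{x\in X:\|x\|=1\}$ the unit sphere. A retraction $R:B_X\to S_X$ is a map with $R(x)=x$ for all $x\in S_X$; it is $k$-Lipschitz if $\|R(x)-R(y)\|\le k\|x-y\|$ for all $x,y\in B_X$. For an infinite-dimensional Banach space $X$, $$k_0(X) := \inf\{k>0 : \text{there exists a } k\text{-Lipschitz retraction } R:B_X\to S_X\}.$$ *)

theory Defs
  imports "HOL-Analysis.Analysis"
begin

text \<open>
  The library proves completeness only for metric domains, which excludes \<^typ>\<open>nat\<close>; the metric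
  on the domain is not needed.
\<close>

instance bcontfun :: (topological_space, complete_space) complete_space
proof
  show "convergent X" if X: "Cauchy X" for X :: "nat \<Rightarrow> 'a \<Rightarrow>\<^sub>C 'b"
  proof -
    have "uniformly_Cauchy_on UNIV (\<lambda>n. apply_bcontfun (X n))"
      using X unfolding Cauchy_def uniformly_Cauchy_on_def by (meson dist_fun_lt_imp_dist_val_lt)
    then have "uniformly_convergent_on UNIV (\<lambda>n. apply_bcontfun (X n))"
      by (rule Cauchy_uniformly_convergent)
    then show ?thesis
      unfolding uniformly_convergent_on_def convergent_def
      by (metis uniform_limit_bcontfunE sequentially_bot)
  qed
qed

instance bcontfun :: (topological_space, banach) banach ..

text \<open>
  Since \<^typ>\<open>nat\<close> carries the discrete topology, bounded continuous functions on it are exactly the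
  bounded sequences, with the supremum norm. Sequences are indexed from 0 instead of 1.
\<close>

type_synonym l_infty = "nat \<Rightarrow>\<^sub>C real"

lemma bcontfun_nat_iff: "(x :: nat \<Rightarrow> real) \<in> bcontfun \<longleftrightarrow> bounded (range x)"
  by (simp add: bcontfun_def)

lemma norm_l_infty: "norm (x :: l_infty) = (SUP n. \<bar>apply_bcontfun x n\<bar>)"
  by (simp add: norm_bcontfun_def dist_bcontfun_def dist_real_def)

text \<open>
  The infimum is taken in \<^typ>\<open>ereal\<close>, so that it is \<open>\<infinity>\<close> if there is no Lipschitz retraction. The
  continuity required by \<^const>\<open>retraction\<close> is implied by the Lipschitz condition.
\<close>

definition k0 :: "'a::banach itself \<Rightarrow> ereal" where
  "k0 _ = Inf {ereal k | k. 0 < k \<and>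
     (\<exists>R :: 'a \<Rightarrow> 'a. retraction (cball 0 1) (sphere 0 1) R \<and> k-lipschitz_on (cball 0 1) R)}"

end

theory Submission
  imports Defs
begin

text \<open>
  The proof exhibits a \<open>20\<close>-Lipschitz retraction of the unit ball of \<^typ>\<open>l_infty\<close> onto the unit
  sphere. Its core is a self-map \<open>T\<close> of the ball without approximate fixed points. Let \<open>T\<close> send
  \<open>x\<close> to the sequence \<open>(h L, clip (3 x\<^sub>0), clip (3 x\<^sub>1), \<dots>)\<close>, where \<open>L = sup x\<close>, where \<open>clip\<close>
  truncates at some level, and where \<open>h\<close> is positive for small arguments and negative for large
  ones. The entries of a fixed point would be driven away from \<open>0\<close>: if one is positive, the next
  ones grow up to the truncation level, so \<open>L\<close> is large and \<open>x\<^sub>0 = h L\<close> is negative; but then all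
  entries are negative, a contradiction. If none is positive, \<open>L\<close> is small, so \<open>x\<^sub>0 = h L\<close> is
  positive, again a contradiction. The expansion factor \<open>3\<close> makes the argument robust, and \<open>x - T x\<close>
  has norm at least \<open>1/5\<close> (\<open>disp_not_small\<close>). The growth needs infinitely many coordinates,
  and a map that is continuous for the weak-* topology, in which the ball is compact, would have a
  fixed point; the supremum is not continuous for that topology.

  On the sphere the retraction must be the identity, so all truncation levels in \<open>T\<close> are bounded by
  \<open>3 (1 - norm x)\<close>. Then \<open>x - T x\<close> is \<open>x\<close> on the sphere; near the sphere \<open>T x\<close> is too small to
  cancel \<open>x\<close> (\<open>disp_ge_near_sphere\<close>), and where it is not, the truncation level is high enough for
  the argument above.

  It remains to push \<open>g = x - T x\<close> onto the sphere. Truncating \<open>5 g\<close> to \<open>[-1, 1]\<close> coordinatewise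
  gives norm \<open>1\<close>, but on the sphere this is not the identity. Writing \<open>5 g = g + 4 g\<close> and truncating
  the summand \<open>4 g\<close> at the level \<open>16 (1 - norm x)\<close> repairs this. A truncation is \<open>1\<close>-Lipschitz for
  the maximum of the changes in its level and in its argument (\<open>clip_lipschitz\<close>), so making the levels
  depend on \<open>x\<close> costs nothing: the Lipschitz constants are \<open>1 + 3 = 4\<close> for \<open>g\<close> and \<open>4 + 16 = 20\<close>
  for the retraction.
\<close>

section \<open>Truncation\<close>

definition clip :: "real \<Rightarrow> real \<Rightarrow> real" where
  "clip a u = max (- a) (min a u)"

lemma abs_clip: "0 \<le> a \<Longrightarrow> \<bar>clip a u\<bar> = min a \<bar>u\<bar>"
  by (auto simp: clip_def)

lemma clip_lipschitz:
  assumes "\<bar>a - b\<bar> \<le> d" and "\<bar>u - v\<bar> \<le> d"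
  shows "\<bar>clip a u - clip b v\<bar> \<le> d"
  using assms unfolding clip_def by linarith

lemma abs_add_clip: "0 \<le> a \<Longrightarrow> 0 \<le> m \<Longrightarrow> \<bar>u + clip a (m * u)\<bar> = \<bar>u\<bar> + min a (m * \<bar>u\<bar>)"
proof (cases "0 \<le> u")
  case True
  assume "0 \<le> a" "0 \<le> m"
  with True have "0 \<le> m * u" by simp
  with True \<open>0 \<le> a\<close> show ?thesis by (auto simp: clip_def)
next
  case False
  assume "0 \<le> a" "0 \<le> m"
  with False have "m * u \<le> 0" by (simp add: mult_nonneg_nonpos)
  with False \<open>0 \<le> a\<close> show ?thesis by (auto simp: clip_def)
qed

section \<open>Bounded sequences\<close>

lemma abs_nth_le_norm: "\<bar>apply_bcontfun (x :: l_infty) n\<bar> \<le> norm x"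
  using norm_bounded[of x n] by simp

lemma abs_nth_diff_le_dist: "\<bar>apply_bcontfun (x :: l_infty) n - apply_bcontfun y n\<bar> \<le> dist x y"
  using dist_bounded[of x n y] by (simp add: dist_real_def)

definition seq_sup :: "l_infty \<Rightarrow> real" where
  "seq_sup x = (SUP n. apply_bcontfun x n)"

lemma nth_le_seq_sup: "apply_bcontfun x n \<le> seq_sup x"
  unfolding seq_sup_def
proof (rule cSUP_upper)
  show "bdd_above (range (apply_bcontfun x))"
    using abs_nth_le_norm[of x] by (intro bdd_aboveI[of _ "norm x"]) (auto simp: abs_le_iff)
qed simp

lemma seq_sup_le: "(\<And>n. apply_bcontfun x n \<le> c) \<Longrightarrow> seq_sup x \<le> c"
  unfolding seq_sup_def by (rule cSUP_least) auto

lemma seq_sup_lipschitz: "\<bar>seq_sup x - seq_sup y\<bar> \<le> dist x y"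
proof -
  have "seq_sup u \<le> seq_sup v + dist u v" for u v
  proof (rule seq_sup_le)
    show "apply_bcontfun u n \<le> seq_sup v + dist u v" for n
      using abs_nth_diff_le_dist[of u n v] nth_le_seq_sup[of v n] by linarith
  qed
  from this[of x y] this[of y x] show ?thesis by (simp add: dist_commute abs_le_iff)
qed

section \<open>A displacement bounded away from zero\<close>

text \<open>
  The displacement \<open>x - T x\<close>. The first entry of \<open>T x\<close>, away from the sphere, is \<open>3/10\<close> for
  \<open>seq_sup x \<le> 1/10\<close> and \<open>-3/10\<close> for \<open>seq_sup x \<ge> 3/10\<close>. The number \<open>1/10\<close> is the fixed point of
  \<open>s \<mapsto> 3 s - 1/5\<close>: above it, entries grow even if each step loses \<open>1/5\<close>; and \<open>3/10 = 1/10 + 1/5\<close>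
  makes the first entry exceed it under the same loss.
\<close>

definition disp :: "l_infty \<Rightarrow> nat \<Rightarrow> real" where
  "disp x n = apply_bcontfun x n -
     (case n of
        0 \<Rightarrow> clip (min (3/10) (3 * (1 - norm x))) (6/10 - 3 * seq_sup x)
      | Suc m \<Rightarrow> clip (3 * (1 - norm x)) (3 * apply_bcontfun x m))"

lemma disp_lipschitz: "\<bar>disp x n - disp y n\<bar> \<le> 4 * dist x y"
proof -
  have norm: "\<bar>norm x - norm y\<bar> \<le> dist x y"
    by (simp add: dist_norm norm_triangle_ineq3)
  show ?thesis
  proof (cases n)
    case 0
    have "\<bar>clip (min (3/10) (3 * (1 - norm x))) (6/10 - 3 * seq_sup x)
         - clip (min (3/10) (3 * (1 - norm y))) (6/10 - 3 * seq_sup y)\<bar> \<le> 3 * dist x y"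
      using norm seq_sup_lipschitz[of x y]
      by (intro clip_lipschitz) (auto simp: abs_le_iff min_def)
    then show ?thesis
      using abs_nth_diff_le_dist[of x 0 y] 0 by (simp add: disp_def)
  next
    case (Suc m)
    have "\<bar>clip (3 * (1 - norm x)) (3 * apply_bcontfun x m)
         - clip (3 * (1 - norm y)) (3 * apply_bcontfun y m)\<bar> \<le> 3 * dist x y"
      using norm abs_nth_diff_le_dist[of x m y]
      by (intro clip_lipschitz) (auto simp: abs_le_iff)
    then show ?thesis
      using abs_nth_diff_le_dist[of x "Suc m" y] Suc by (simp add: disp_def)
  qed
qed

lemma disp_sphere: "norm x = 1 \<Longrightarrow> disp x n = apply_bcontfun x n"
  by (simp add: disp_def clip_def split: nat.split)

text \<open>
  The entries of \<open>T x\<close> never exceed the truncation level \<open>3 (1 - norm x)\<close>, which near the sphere is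
  smaller than \<open>norm x\<close>.
\<close>

lemma disp_ge_near_sphere:
  assumes "norm x \<le> 1" and small: "\<And>n. \<bar>disp x n\<bar> \<le> g"
  shows "norm x - 3 * (1 - norm x) \<le> g"
proof -
  have "\<bar>apply_bcontfun x n\<bar> \<le> g + 3 * (1 - norm x)" for n
  proof -
    have "\<bar>apply_bcontfun x n - disp x n\<bar> \<le> 3 * (1 - norm x)"
      using assms(1) by (auto simp: disp_def abs_clip split: nat.split)
    then show ?thesis using small[of n] by linarith
  qed
  then have "norm x \<le> g + 3 * (1 - norm x)"
    by (intro norm_bound) simp
  then show ?thesis by linarith
qed

text \<open>
  If every displacement is below \<open>1/5\<close>, the first entry forces the supremum above \<open>1/10\<close>, expansion
  then forces it up to \<open>4/10\<close>, and so the first entry, hence every entry, is at most \<open>-1/10\<close>.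
  The truncation level does not interfere: it exceeds \<open>6/10\<close> here, by the bound near the sphere.
\<close>

lemma disp_not_small:
  assumes "norm x \<le> 1" and small: "\<And>n. \<bar>disp x n\<bar> \<le> g"
  shows "1/5 \<le> g"
proof (rule ccontr)
  assume "\<not> 1/5 \<le> g"
  then have g: "g < 1/5" by simp
  define r where "r = 3 * (1 - norm x)"
  define L where "L = seq_sup x"
  have r: "6/10 < r"
    using disp_ge_near_sphere[OF assms] g by (simp add: r_def)
  have first: "\<bar>apply_bcontfun x 0 - clip (3/10) (6/10 - 3 * L)\<bar> \<le> g"
    using small[of 0] r by (simp add: disp_def r_def L_def min_def split: if_splits)
  have step: "\<bar>apply_bcontfun x (Suc n) - clip r (3 * apply_bcontfun x n)\<bar> \<le> g" for n
    using small[of "Suc n"] by (simp add: disp_def r_def)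
  have le_L: "apply_bcontfun x n \<le> L" for n
    by (simp add: L_def nth_le_seq_sup)
  have "1/10 < L"
    using first g le_L[of 0] by (simp add: clip_def max_def min_def split: if_splits)
  \<comment> \<open>An entry close to the supremum is followed by one that would exceed it, unless the supremum
    is near the truncation level.\<close>
  have "4/10 \<le> L"
  proof (rule ccontr)
    assume low: "\<not> 4/10 \<le> L"
    have "apply_bcontfun x n \<le> (L + g) / 3" for n
      using step[of n] le_L[of "Suc n"] low g r
      by (simp add: clip_def max_def min_def split: if_splits)
    then have "L \<le> (L + g) / 3" unfolding L_def by (rule seq_sup_le)
    with \<open>1/10 < L\<close> g show False by simp
  qed
  then have start: "apply_bcontfun x 0 \<le> - (1/10)"
    using first g by (simp add: clip_def)
  have "apply_bcontfun x n \<le> - (1/10)" for n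
  proof (induction n)
    case (Suc n)
    then show ?case
      using step[of n] g r by (simp add: clip_def max_def min_def split: if_splits)
  qed (rule start)
  then have "L \<le> - (1/10)" unfolding L_def by (rule seq_sup_le)
  with \<open>4/10 \<le> L\<close> show False by simp
qed

section \<open>The retraction\<close>

definition sphere_retr :: "l_infty \<Rightarrow> l_infty" where
  "sphere_retr x = Bcontfun (\<lambda>n. clip 1 (disp x n + clip (16 * (1 - norm x)) (4 * disp x n)))"

lemma sphere_retr_nth:
  "apply_bcontfun (sphere_retr x) n = clip 1 (disp x n + clip (16 * (1 - norm x)) (4 * disp x n))"
proof -
  have "(\<lambda>n. clip 1 (disp x n + clip (16 * (1 - norm x)) (4 * disp x n))) \<in> bcontfun"
    unfolding bcontfun_nat_iff by (rule boundedI[of _ 1]) (auto simp: abs_clip)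
  then show ?thesis by (simp add: sphere_retr_def Bcontfun_inverse)
qed

lemma sphere_retr_lipschitz: "20-lipschitz_on UNIV sphere_retr"
proof (rule lipschitz_onI)
  fix x y :: l_infty
  have norm: "\<bar>norm x - norm y\<bar> \<le> dist x y"
    by (simp add: dist_norm norm_triangle_ineq3)
  show "dist (sphere_retr x) (sphere_retr y) \<le> 20 * dist x y"
  proof (rule dist_bound)
    fix n
    have "\<bar>clip (16 * (1 - norm x)) (4 * disp x n) - clip (16 * (1 - norm y)) (4 * disp y n)\<bar>
        \<le> 16 * dist x y"
      using norm disp_lipschitz[of x n y]
      by (intro clip_lipschitz) (auto simp: abs_le_iff)
    then have "\<bar>apply_bcontfun (sphere_retr x) n - apply_bcontfun (sphere_retr y) n\<bar>
        \<le> 20 * dist x y"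
      unfolding sphere_retr_nth using disp_lipschitz[of x n y]
      by (intro clip_lipschitz) (simp, linarith)
    then show "dist (apply_bcontfun (sphere_retr x) n) (apply_bcontfun (sphere_retr y) n)
        \<le> 20 * dist x y"
      by (simp add: dist_real_def)
  qed
qed simp

lemma sphere_retr_sphere: "norm x = 1 \<Longrightarrow> sphere_retr x = x"
proof (rule bcontfun_eqI)
  show "apply_bcontfun (sphere_retr x) n = apply_bcontfun x n" if "norm x = 1" for n
    using that abs_nth_le_norm[of x n] by (auto simp: sphere_retr_nth disp_sphere clip_def)
qed

lemma norm_sphere_retr:
  assumes "norm x \<le> 1"
  shows "norm (sphere_retr x) = 1"
proof (rule antisym)
  show "norm (sphere_retr x) \<le> 1"
    by (rule norm_bound) (simp add: sphere_retr_nth abs_clip)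
  define q where "q = norm (sphere_retr x)"
  define t where "t = 1 - norm x"
  have t: "0 \<le> t" using assms by (simp add: t_def)
  show "1 \<le> norm (sphere_retr x)"
  proof (rule ccontr)
    assume "\<not> 1 \<le> norm (sphere_retr x)"
    then have q: "q < 1" by (simp add: q_def)
    have bound: "\<bar>disp x n\<bar> + min (16 * t) (4 * \<bar>disp x n\<bar>) \<le> q" for n
      using abs_nth_le_norm[of "sphere_retr x" n] q t
      by (simp add: q_def[symmetric] sphere_retr_nth abs_clip abs_add_clip t_def[symmetric])
    have *: "\<bar>disp x n\<bar> \<le> max (q / 5) (q - 16 * t)" for n
      using bound[of n] by (cases "16 * t \<le> 4 * \<bar>disp x n\<bar>") (simp_all add: min_def le_max_iff_disj)
    \<comment> \<open>The first bound on the displacement excludes the untruncated case \<open>q / 5\<close>, the bound near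
      the sphere the truncated one.\<close>
    show False
      using disp_not_small[OF assms *] disp_ge_near_sphere[OF assms *] q t
      by (simp add: t_def max_def split: if_splits)
  qed
qed

theorem theorem3p2:
  shows "k0 TYPE(l_infty) \<le> ereal 20.5"
proof -
  have lip: "20-lipschitz_on (cball 0 1) sphere_retr"
    using sphere_retr_lipschitz by (rule lipschitz_on_subset) simp
  then have "retraction (cball 0 1) (sphere 0 1) sphere_retr"
    unfolding retraction_def
    by (auto intro: lipschitz_on_continuous_on simp: norm_sphere_retr sphere_retr_sphere)
  with lip have "k0 TYPE(l_infty) \<le> ereal 20"
    unfolding k0_def by (intro Inf_lower) force
  also have "\<dots> \<le> ereal 20.5" by simp
  finally show ?thesis .
qed

end
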